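(* Let $a,b$ be positive integers and let $\mathbb{E}^a$ and $\mathbb{E}^b$ be the Euclidean spaces of dimensions $a$ and $b$. Then $$e(\mathbb{E}^a\oplus_\infty\mathbb{E}^b)\le (a+1)(b+1)+1.$$
   Context: $\mathbb{E}^n$ denotes $\mathbb{R}^n$ with the standard Euclidean norm $\|\cdot\|$. The space $\mathbb{E}^{a}\oplus_\infty\mathbb{E}^{b}$ is the product $\mathbb{E}^a\times\mathbb{E}^b$ equipped with the norm $\|(x_1,x_2)\|_\infty=\max(\|x_1\|,\|x_2\|)$ for $x_1\in\mathbb{E}^a$, $x_2\in\mathbb{E}^b$, and distance $\|x-y\|_\infty$. A subset $S$ of a normed space is an equilateral set if the distances between distinct points of $S$ take only one value. $e(X)$ denotes the maximum cardinality of an equilateral set in $X$; thus $e(X)\le N$ means that every equilateral set in $X$ has at most $N$ points. *)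

theory Defs
  imports "HOL-Analysis.Analysis" "HOL-Library.Extended_Nat"
begin

text \<open>
  The product type carries the Euclidean product norm as its \<open>norm\<close>, so the norm of the
  \<open>\<infinity>\<close>-sum is a separate function, and the notions below take the norm as a parameter.
\<close>

definition norm_inf_sum :: "'a::real_normed_vector \<times> 'b::real_normed_vector \<Rightarrow> real" where
  "norm_inf_sum x = max (norm (fst x)) (norm (snd x))"

definition equilateral :: "('v::real_vector \<Rightarrow> real) \<Rightarrow> 'v set \<Rightarrow> bool" where
  "equilateral N S \<longleftrightarrow> (\<exists>c. \<forall>x\<in>S. \<forall>y\<in>S. x \<noteq> y \<longrightarrow> N (x - y) = c)"

text \<open>
  The maximum cardinality of an equilateral set, as a supremum in the extended naturals; an
  infinite set counts as \<open>\<infinity>\<close> (its \<open>card\<close> would be 0). If the supremum is finite, it is attained.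
\<close>

definition equilateral_number :: "('v::real_vector \<Rightarrow> real) \<Rightarrow> enat" where
  "equilateral_number N =
    (SUP S\<in>{S. equilateral N S}. if finite S then enat (card S) else \<infinity>)"

lemma equilateral_number_le_iff:
  "equilateral_number N \<le> enat n \<longleftrightarrow> (\<forall>S. equilateral N S \<longrightarrow> finite S \<and> card S \<le> n)"
  unfolding equilateral_number_def SUP_le_iff by (auto split: if_splits)

end

theory Submission
  imports Defs
begin

text \<open>
  If \<open>c\<close> is the common distance, the product of the kernels \<open>c\<^sup>2 (c\<^sup>2 - dist x x'\<^sup>2)\<close> and
  \<open>c\<^sup>2 (c\<^sup>2 - dist y y'\<^sup>2)\<close> is a positive multiple of the identity matrix on an equilateral set.
  Each kernel is a Gram kernel in dimension \<open>a + 1\<close> (respectively \<open>b + 1\<close>) minus a rank one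
  Gram kernel. Multiplying out, the product is a Gram kernel in dimension \<open>(a + 1) (b + 1) + 1\<close>
  minus a positive semidefinite one, so it has at most that many positive eigenvalues.
\<close>

text \<open>The family \<open>g\<close> may repeat values, whereas \<open>dependent\<close> speaks
  of sets. If \<open>g\<close> is injective on \<open>S\<close>, its image has more than
  \<open>DIM('v)\<close> elements and is dependent; a repeated value gives a relation
  directly.\<close>

lemma exists_nontrivial_relation:
  fixes g :: "'p \<Rightarrow> 'v::euclidean_space"
  assumes "finite S" and "DIM('v) < card S"
  obtains w where "(\<Sum>i\<in>S. w i *\<^sub>R g i) = 0" and "\<exists>i\<in>S. w i \<noteq> 0"
proof (cases "inj_on g S")
  case True
  then have "dependent (g ` S)"
    using assms by (intro dependent_biggerset) (auto simp: card_image)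
  then obtain u where "\<exists>v\<in>g ` S. u v \<noteq> 0" and "(\<Sum>v\<in>g ` S. u v *\<^sub>R v) = 0"
    using assms(1) by (auto simp: dependent_finite)
  then show ?thesis
    using that[of "u \<circ> g"] by (auto simp: sum.reindex[OF True])
next
  case False
  then obtain i j where ij: "i \<in> S" "j \<in> S" "i \<noteq> j" "g i = g j"
    by (auto simp: inj_on_def)
  define w :: "'p \<Rightarrow> real" where "w k = of_bool (k = i) - of_bool (k = j)" for k
  have "(\<Sum>k\<in>S. w k *\<^sub>R g k) = (\<Sum>k\<in>S. if k = i then g k else 0) - (\<Sum>k\<in>S. if k = j then g k else 0)"
    unfolding sum_subtractf[symmetric] w_def by (intro sum.cong) auto
  also have "\<dots> = 0"
    using ij assms(1) by simp
  finally have "(\<Sum>k\<in>S. w k *\<^sub>R g k) = 0" .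
  moreover have "w i \<noteq> 0"
    using ij by (simp add: w_def)
  ultimately show ?thesis
    using that ij(1) by blast
qed

lemma norm_sum_scaleR_sq:
  fixes g :: "'p \<Rightarrow> 'v::real_inner"
  shows "(norm (\<Sum>i\<in>S. w i *\<^sub>R g i))\<^sup>2 = (\<Sum>i\<in>S. \<Sum>j\<in>S. w i * w j * (g i \<bullet> g j))"
  unfolding power2_norm_eq_inner inner_sum_left inner_sum_right
  by (intro sum.cong refl) (simp add: inner_commute)

text \<open>More than \<open>DIM('u)\<close> vectors \<open>G i\<close> would satisfy a nontrivial
  relation \<open>w\<close>. At \<open>w\<close> the quadratic form of the difference of the Gram
  matrices is minus a squared norm, yet this difference is diagonal with positive entries, so the
  form is positive.\<close>

lemma card_le_DIM_if_diagonal_Gram_difference: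
  fixes G :: "'p \<Rightarrow> 'u::euclidean_space" and H :: "'p \<Rightarrow> 'v::real_inner"
  assumes fin: "finite S"
    and diag: "\<And>i. i \<in> S \<Longrightarrow> G i \<bullet> G i > H i \<bullet> H i"
    and off_diag: "\<And>i j. i \<in> S \<Longrightarrow> j \<in> S \<Longrightarrow> i \<noteq> j \<Longrightarrow> G i \<bullet> G j = H i \<bullet> H j"
  shows "card S \<le> DIM('u)"
proof (rule ccontr)
  assume "\<not> card S \<le> DIM('u)"
  then obtain w where rel: "(\<Sum>i\<in>S. w i *\<^sub>R G i) = 0" and nz: "\<exists>i\<in>S. w i \<noteq> 0"
    using exists_nontrivial_relation[OF fin, of G] by auto
  have "- (norm (\<Sum>i\<in>S. w i *\<^sub>R H i))\<^sup>2
      = (norm (\<Sum>i\<in>S. w i *\<^sub>R G i))\<^sup>2 - (norm (\<Sum>i\<in>S. w i *\<^sub>R H i))\<^sup>2"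
    using rel by simp
  also have "\<dots> = (\<Sum>i\<in>S. \<Sum>j\<in>S. w i * w j * (G i \<bullet> G j - H i \<bullet> H j))"
    unfolding norm_sum_scaleR_sq by (simp add: sum_subtractf right_diff_distrib)
  also have "\<dots> = (\<Sum>i\<in>S. \<Sum>j\<in>S. if j = i then (w i)\<^sup>2 * (G i \<bullet> G i - H i \<bullet> H i) else 0)"
    using off_diag by (intro sum.cong refl) (auto simp: power2_eq_square)
  also have "\<dots> = (\<Sum>i\<in>S. (w i)\<^sup>2 * (G i \<bullet> G i - H i \<bullet> H i))"
    using fin by simp
  also have "\<dots> > 0"
  proof -
    obtain i where i: "i \<in> S" "w i \<noteq> 0"
      using nz by blast
    show ?thesis
      using fin i(1)
    proof (rule sum_pos2)
      show "0 < (w i)\<^sup>2 * (G i \<bullet> G i - H i \<bullet> H i)"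
        using i diag by simp
      show "0 \<le> (w j)\<^sup>2 * (G j \<bullet> G j - H j \<bullet> H j)" if "j \<in> S" for j
        using diag[OF that] by simp
    qed
  qed
  finally show False
    using zero_le_power2[of "norm (\<Sum>i\<in>S. w i *\<^sub>R H i)"] by linarith
qed

text \<open>The factor \<open>sqrt 2 * c\<close> yields the cross term
  \<open>2 * c\<^sup>2 * (x \<bullet> y)\<close> of the distance kernel. The product of the last
  coordinates yields its other terms, with the rank one excess
  \<open>(norm x)\<^sup>2 * (norm y)\<^sup>2\<close>.\<close>

definition dist_feature :: "real \<Rightarrow> 'v::real_inner \<Rightarrow> 'v \<times> real" where
  "dist_feature c x = ((sqrt 2 * c) *\<^sub>R x, c\<^sup>2 - (norm x)\<^sup>2)"

lemma dist_feature_inner: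
  "dist_feature c x \<bullet> dist_feature c y - (norm x)\<^sup>2 * (norm y)\<^sup>2 = c\<^sup>2 * (c\<^sup>2 - (norm (x - y))\<^sup>2)"
  unfolding dist_feature_def power2_norm_eq_inner
  by (simp add: algebra_simps inner_commute power2_eq_square)

text \<open>The tensor product is stored as one multiple of \<open>v\<close> per coordinate of
  \<open>u\<close>, so for Euclidean \<open>'w\<close> the type has dimension
  \<open>(CARD('n) + 1) * DIM('w)\<close>.\<close>

definition tensor :: "(real ^ 'n) \<times> real \<Rightarrow> 'w::real_inner \<Rightarrow> ('w ^ 'n) \<times> 'w" where
  "tensor u v = ((\<chi> k. (fst u $ k) *\<^sub>R v), snd u *\<^sub>R v)"

lemma tensor_inner: "tensor u v \<bullet> tensor u' v' = (u \<bullet> u') * (v \<bullet> v')"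
proof -
  have "(\<Sum>k\<in>UNIV. (fst u' $ k) * ((fst u $ k) * (v \<bullet> v'))) = (fst u \<bullet> fst u') * (v \<bullet> v')"
    by (simp add: inner_vec_def sum_distrib_left mult_ac)
  then show ?thesis
    by (simp add: tensor_def inner_prod_def inner_vec_def[where x = "vec_lambda f" for f]
        distrib_right mult.assoc)
qed

lemma card_equilateral_norm_inf_sum_le:
  fixes S :: "((real ^ 'a::finite) \<times> (real ^ 'b::finite)) set"
  assumes fin: "finite S" and c: "c > 0"
    and dist: "\<And>z z'. z \<in> S \<Longrightarrow> z' \<in> S \<Longrightarrow> z \<noteq> z' \<Longrightarrow> norm_inf_sum (z - z') = c"
  shows "card S \<le> (CARD('a) + 1) * (CARD('b) + 1) + 1"
proof -
  \<comment> \<open>Write the two kernels as \<open>P - p\<close> and \<open>Q - q\<close>, with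
    \<open>p\<close> and \<open>q\<close> the rank one terms. Their product is
    \<open>(P * Q + p * q) - (q * P + p * Q)\<close>: \<open>G\<close> realizes the first bracket,
    \<open>H\<close> the second.\<close>
  define G where
    "G z = (tensor (dist_feature c (fst z)) (dist_feature c (snd z)), (norm (fst z))\<^sup>2 * (norm (snd z))\<^sup>2)"
    for z :: "(real ^ 'a) \<times> (real ^ 'b)"
  define H where
    "H z = ((norm (snd z))\<^sup>2 *\<^sub>R dist_feature c (fst z), (norm (fst z))\<^sup>2 *\<^sub>R dist_feature c (snd z))"
    for z :: "(real ^ 'a) \<times> (real ^ 'b)"
  have kernel: "G z \<bullet> G z' - H z \<bullet> H z'
      = (c\<^sup>2 * (c\<^sup>2 - (norm (fst z - fst z'))\<^sup>2)) * (c\<^sup>2 * (c\<^sup>2 - (norm (snd z - snd z'))\<^sup>2))" for z z'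
    unfolding dist_feature_inner[symmetric] G_def H_def
    by (simp add: tensor_inner algebra_simps)
  \<comment> \<open>With \<open>a = CARD('a)\<close> and \<open>b = CARD('b)\<close> this dimension
    is \<open>(b + 1) * a + (b + 1) + 1\<close>.\<close>
  have "card S \<le> DIM(((((real ^ 'b) \<times> real) ^ 'a) \<times> ((real ^ 'b) \<times> real)) \<times> real)"
  proof (rule card_le_DIM_if_diagonal_Gram_difference[OF fin, of H G])
    show "G z \<bullet> G z > H z \<bullet> H z" if "z \<in> S" for z
    proof -
      \<comment> \<open>On the diagonal both distances vanish and the kernel is
        \<open>c ^ 8\<close>.\<close>
      have "G z \<bullet> G z - H z \<bullet> H z > 0"
        unfolding kernel using c by simp
      then show ?thesis
        by simp
    qed
    \<comment> \<open>The maximum \<open>c\<close> is attained by one of the two component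
      distances, so a factor of the kernel vanishes.\<close>
    show "G z \<bullet> G z' = H z \<bullet> H z'" if "z \<in> S" "z' \<in> S" "z \<noteq> z'" for z z'
      using kernel[of z z'] dist[OF that] by (auto simp: norm_inf_sum_def max_def split: if_splits)
  qed
  then show ?thesis
    by (simp add: algebra_simps)
qed

theorem theorem4:
  "equilateral_number (norm_inf_sum :: (real ^ 'a::finite) \<times> (real ^ 'b::finite) \<Rightarrow> real)
    \<le> enat ((CARD('a) + 1) * (CARD('b) + 1) + 1)"
  unfolding equilateral_number_le_iff
proof (intro allI impI)
  fix S :: "((real ^ 'a) \<times> (real ^ 'b)) set"
  assume "equilateral norm_inf_sum S"
  then obtain c where c: "\<And>z z'. z \<in> S \<Longrightarrow> z' \<in> S \<Longrightarrow> z \<noteq> z' \<Longrightarrow> norm_inf_sum (z - z') = c"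
    unfolding equilateral_def by blast
  show "finite S \<and> card S \<le> (CARD('a) + 1) * (CARD('b) + 1) + 1"
  \<comment> \<open>A uniform bound on the finite subsets also gives finiteness of
    \<open>S\<close>.\<close>
  proof (rule finite_if_finite_subsets_card_bdd)
    fix T
    assume T: "T \<subseteq> S" "finite T"
    show "card T \<le> (CARD('a) + 1) * (CARD('b) + 1) + 1"
    \<comment> \<open>Two distinct points force \<open>c > 0\<close>; if \<open>S\<close> has at
      most one point, \<open>c\<close> is arbitrary.\<close>
    proof (cases "\<exists>z\<in>T. \<exists>z'\<in>T. z \<noteq> z'")
      case True
      then obtain z z' where z: "z \<in> T" "z' \<in> T" "z \<noteq> z'"
        by blast
      then have "c = norm_inf_sum (z - z')"
        using c T(1) by blast
      also have "\<dots> > 0"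
        using z(3) by (auto simp: norm_inf_sum_def less_max_iff_disj prod_eq_iff)
      finally show ?thesis
        using card_equilateral_norm_inf_sum_le[OF T(2)] c T(1) by blast
    next
      case False
      then have "card T \<le> 1"
        using T(2) by (auto simp: card_le_Suc0_iff_eq)
      then show ?thesis
        by simp
    qed
  qed
qed

end
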